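(* Let $\operatorname{opt}_{\max}$, $\operatorname{opt}_{\mathcal{M}}$ and $\operatorname{opt}_{\mathrm{int}}$ denote the maximality, E-admissibility and interval dominance choice functions induced by the credal set $\mathcal{M}$. For any consistent decision tree $T$, $$\operatorname{norm}_{\operatorname{opt}_{\max}}(T)=\operatorname{norm}_{\operatorname{opt}_{\max}}(\operatorname{back}_{\operatorname{opt}_{\mathrm{int}}}(T))$$ and $$\operatorname{norm}_{\operatorname{opt}_{\mathcal{M}}}(T)=\operatorname{norm}_{\operatorname{opt}_{\mathcal{M}}}(\operatorname{back}_{\operatorname{opt}_{\mathrm{int}}}(T)).$$
   Context: **Uncertainty model.** $\Omega$ is a finite non-empty set (possibility space); events are subsets of $\Omega$, and $\overline{A}$ is the complement of $A$. A gamble is a function $X\colon\Omega\to\mathbb{R}$. An event also denotes its indicator, so $AX$ means $I_A X$. $\mathcal{M}$ is a (non-empty) closed convex set of probability mass functions on $\Omega$ with $p(\omega)>0$ for all $p\in\mathcal{M}$, $\omega\in\Omega$. For a non-empty event $A$ and $p\in\mathcal{M}$, $E_p(X|A)=\frac{\sum_{\omega\in A}X(\omega)p(\omega)}{\sum_{\omega\in A}p(\omega)}$, $\underline{P}(X|A)=\min_{p\in\mathcal{M}}E_p(X|A)$, $\overline{P}(X|A)=\max_{p\in\mathcal{M}}E_p(X|A)$. **Choice functions.** A choice function $\operatorname{opt}$ maps, for each non-empty event $A$, each non-empty finite set $\mathcal{X}$ of gambles to a non-empty subset $\operatorname{opt}(\mathcal{X}|A)\subseteq\mathcal{X}$. Maximality: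 $\operatorname{opt}_{\max}(\mathcal{X}|A)=\{X\in\mathcal{X}\colon \text{there is no }Y\in\mathcal{X}\text{ with }\underline{P}(Y-X|A)>0\}$. E-admissibility: $\operatorname{opt}_{\mathcal{M}}(\mathcal{X}|A)=\bigcup_{p\in\mathcal{M}}\{X\in\mathcal{X}\colon(\forall Y\in\mathcal{X})(E_p(Y|A)\leq E_p(X|A))\}$. Interval dominance: $\operatorname{opt}_{\mathrm{int}}(\mathcal{X}|A)=\{X\in\mathcal{X}\colon\text{there is no }Y\in\mathcal{X}\text{ with }\underline{P}(Y|A)>\overline{P}(X|A)\}$. **Decision trees.** A decision tree is a finite rooted tree whose nodes are reward leaves (labelled by real numbers), decision nodes, and chance nodes; the arcs leaving a chance node are labelled by events forming a partition of $\Omega$. With every tree $T$ is associated an event $\operatorname{ev}(T)$, the intersection of all events on chance arcs that precede $T$. For a node $N$ of $T$, $\operatorname{st}_N(T)$ denotes the subtree of $T$ at $N$ (all non-descendants of $N$ removed); $\operatorname{ev}(\operatorname{st}_N(T))$ is the intersection of $\operatorname{ev}(T)$ with all events on the chance arcs on the path from the root of $T$ to $N$. $T$ is consistent if $\operatorname{ev}(\operatorname{st}_N(T))\neq\emptyset$ for every node $N$ of $T$. **Normal form decisions and gambles.** A normal form decision of $T$ is a reduced tree obtained from $T$ by keeping exactly one arc at each decision node (and discarding the parts no longer reachable); it has the same associated event $\operatorname{ev}(T)$. $\operatorname{nfd}(T)$ is the set of all of them. Each normal form decision $U$ has a gamble: a leaf with reward $r$ gives the constant gamble $r$; a decision node gives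 the gamble of its single remaining subtree; a chance node with events $E_1,\dots,E_n$ whose subtrees have gambles $X_1,\dots,X_n$ gives $\sum_{i=1}^n E_iX_i$. For $U\in\operatorname{nfd}(T)$, $\operatorname{gamb}(U)$ is the singleton containing its gamble; for a set $\mathcal{U}$ of normal form decisions $\operatorname{gamb}(\mathcal{U})=\bigcup_{U\in\mathcal{U}}\operatorname{gamb}(U)$; and $\operatorname{gamb}(T)=\operatorname{gamb}(\operatorname{nfd}(T))$. **The two solution operators.** For a choice function $\operatorname{opt}$ and a consistent tree $T$, $$\operatorname{norm}_{\operatorname{opt}}(T)=\{U\in\operatorname{nfd}(T)\colon\operatorname{gamb}(U)\subseteq\operatorname{opt}(\operatorname{gamb}(T)|\operatorname{ev}(T))\},$$ and for a non-empty set $\mathcal{U}\subseteq\operatorname{nfd}(T)$, $$\operatorname{norm}_{\operatorname{opt}}(\mathcal{U})=\{U\in\mathcal{U}\colon\operatorname{gamb}(U)\subseteq\operatorname{opt}(\operatorname{gamb}(\mathcal{U})|\operatorname{ev}(T))\}.$$ The normal form backward induction operator $\operatorname{back}_{\operatorname{opt}}$ is defined recursively from right to left: if $T$ is a reward leaf, $\operatorname{back}_{\operatorname{opt}}(T)=\{T\}$. Otherwise, let $S(T)$ be the set of those $U\in\operatorname{nfd}(T)$ such that, for each child subtree $T_i$ of the root of $T$ that is retained in $U$ (all children if the root is a chance node, the chosen child if it is a decision node), the restriction of $U$ to $T_i$ belongs to $\operatorname{back}_{\operatorname{opt}}(T_i)$, where $T_i$ carries its event $\operatorname{ev}(T_i)$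 as a subtree of $T$; then $\operatorname{back}_{\operatorname{opt}}(T)=\operatorname{norm}_{\operatorname{opt}}(S(T))$. *)

theory Defs
  imports "HOL-Analysis.Analysis"
begin

section \<open>Credal sets and conditional expectations\<close>

text \<open>
  The possibility space is the (finite, non-empty) universe of a type \<open>'w\<close> of class \<open>finite\<close>.
  Probability mass functions are vectors in \<open>real ^ 'w\<close>, so that \<^const>\<open>closed\<close> and \<^const>\<open>convex\<close>
  are the usual notions of Euclidean space.
\<close>

type_synonym 'w gamble = "'w \<Rightarrow> real"

definition credal_set :: "(real ^ 'w::finite) set \<Rightarrow> bool" where
  "credal_set M \<longleftrightarrow> M \<noteq> {} \<and> closed M \<and> convex M \<and>
     (\<forall>p\<in>M. (\<forall>w. p $ w > 0) \<and> (\<Sum>w\<in>UNIV. p $ w) = 1)"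

definition cexp :: "real ^ 'w::finite \<Rightarrow> 'w gamble \<Rightarrow> 'w set \<Rightarrow> real" where
  "cexp p X A = (\<Sum>w\<in>A. X w * p $ w) / (\<Sum>w\<in>A. p $ w)"

text \<open>
  On a credal set and a non-empty event, the infimum and the supremum are attained
  (\<open>lower_exp_attained\<close>, \<open>upper_exp_attained\<close> below), i.e. they are a minimum and a maximum.
\<close>

definition lower_exp :: "(real ^ 'w::finite) set \<Rightarrow> 'w gamble \<Rightarrow> 'w set \<Rightarrow> real" where
  "lower_exp M X A = (INF p\<in>M. cexp p X A)"

definition upper_exp :: "(real ^ 'w::finite) set \<Rightarrow> 'w gamble \<Rightarrow> 'w set \<Rightarrow> real" where
  "upper_exp M X A = (SUP p\<in>M. cexp p X A)"

lemma credal_set_compact: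
  assumes "credal_set M"
  shows "compact M"
proof -
  have "norm p \<le> 1" if "p \<in> M" for p
  proof -
    have p: "p $ w > 0" "(\<Sum>w\<in>UNIV. p $ w) = 1" for w
      using assms that by (auto simp: credal_set_def)
    have "norm p \<le> (\<Sum>w\<in>UNIV. \<bar>p $ w\<bar>)"
      by (rule norm_le_l1_cart)
    also have "\<dots> = 1"
      using p by (simp add: abs_of_pos)
    finally show ?thesis .
  qed
  then have "bounded M"
    by (auto simp: bounded_iff)
  with assms show ?thesis
    by (auto simp: credal_set_def compact_eq_bounded_closed)
qed

lemma continuous_on_cexp:
  assumes "credal_set M" "A \<noteq> {}"
  shows "continuous_on M (\<lambda>p. cexp p X A)"
proof -
  have "(\<Sum>w\<in>A. p $ w) \<noteq> 0" if "p \<in> M" for p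
  proof -
    have "(\<Sum>w\<in>A. p $ w) > 0"
      using assms that by (intro sum_pos) (auto simp: credal_set_def)
    then show ?thesis by simp
  qed
  then show ?thesis
    unfolding cexp_def by (intro continuous_intros) auto
qed

lemma lower_exp_attained:
  assumes "credal_set M" "A \<noteq> {}"
  shows "\<exists>p\<in>M. lower_exp M X A = cexp p X A \<and> (\<forall>q\<in>M. cexp p X A \<le> cexp q X A)"
proof -
  obtain p where p: "p \<in> M" "\<forall>q\<in>M. cexp p X A \<le> cexp q X A"
    using continuous_attains_inf[OF credal_set_compact[OF assms(1)] _ continuous_on_cexp[OF assms, of X]] assms(1)
    by (force simp: credal_set_def)
  then have "lower_exp M X A = cexp p X A"
    unfolding lower_exp_def by (intro cInf_eq_minimum) auto
  with p show ?thesis by blast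
qed

lemma upper_exp_attained:
  assumes "credal_set M" "A \<noteq> {}"
  shows "\<exists>p\<in>M. upper_exp M X A = cexp p X A \<and> (\<forall>q\<in>M. cexp q X A \<le> cexp p X A)"
proof -
  obtain p where p: "p \<in> M" "\<forall>q\<in>M. cexp q X A \<le> cexp p X A"
    using continuous_attains_sup[OF credal_set_compact[OF assms(1)] _ continuous_on_cexp[OF assms, of X]] assms(1)
    by (force simp: credal_set_def)
  then have "upper_exp M X A = cexp p X A"
    unfolding upper_exp_def by (intro cSup_eq_maximum) auto
  with p show ?thesis by blast
qed


section \<open>Choice functions\<close>

type_synonym 'w choice = "'w gamble set \<Rightarrow> 'w set \<Rightarrow> 'w gamble set"

definition opt_max :: "(real ^ 'w::finite) set \<Rightarrow> 'w choice" where
  "opt_max M \<X> A = {X\<in>\<X>. \<not> (\<exists>Y\<in>\<X>. lower_exp M (\<lambda>w. Y w - X w) A > 0)}"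

definition opt_adm :: "(real ^ 'w::finite) set \<Rightarrow> 'w choice" where
  "opt_adm M \<X> A = (\<Union>p\<in>M. {X\<in>\<X>. \<forall>Y\<in>\<X>. cexp p Y A \<le> cexp p X A})"

definition opt_int :: "(real ^ 'w::finite) set \<Rightarrow> 'w choice" where
  "opt_int M \<X> A = {X\<in>\<X>. \<not> (\<exists>Y\<in>\<X>. lower_exp M Y A > upper_exp M X A)}"


section \<open>Decision trees\<close>

text \<open>
  The arcs of a decision node carry labels, which identify the arcs: a decision node may have
  several equal subtrees, and retaining one or another of them gives different normal form
  decisions.
\<close>

datatype ('a, 'w) dtree =
    Leaf real
  | Decision "('a \<times> ('a, 'w) dtree) list"
  | Chance "('w set \<times> ('a, 'w) dtree) list"

text \<open>
  The event associated with a tree is not determined by the tree itself, as the tree may be part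
  of a larger one. It is passed as a separate argument \<open>A\<close> throughout.
  \<open>subtrees A T\<close> consists of the pairs of the event and the subtree at the nodes of \<open>T\<close>.
\<close>

fun subtrees :: "'w set \<Rightarrow> ('a, 'w) dtree \<Rightarrow> ('w set \<times> ('a, 'w) dtree) set" where
  "subtrees A (Leaf r) = {(A, Leaf r)}"
| "subtrees A (Decision ds) = insert (A, Decision ds) (\<Union>(a, T)\<in>set ds. subtrees A T)"
| "subtrees A (Chance cs) = insert (A, Chance cs) (\<Union>(E, T)\<in>set cs. subtrees (A \<inter> E) T)"

definition consistent :: "'w set \<Rightarrow> ('a, 'w) dtree \<Rightarrow> bool" where
  "consistent A T \<longleftrightarrow> (\<forall>(B, S)\<in>subtrees A T. B \<noteq> {})"

fun well_formed :: "('a, 'w) dtree \<Rightarrow> bool" where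
  "well_formed (Leaf r) \<longleftrightarrow> True"
| "well_formed (Decision ds) \<longleftrightarrow>
     ds \<noteq> [] \<and> distinct (map fst ds) \<and> (\<forall>(a, T)\<in>set ds. well_formed T)"
| "well_formed (Chance cs) \<longleftrightarrow>
     distinct (map fst cs) \<and> partition_on UNIV (set (map fst cs)) \<and>
     (\<forall>(E, T)\<in>set cs. well_formed T)"


section \<open>Normal form decisions and their gambles\<close>

fun nfd :: "('a, 'w) dtree \<Rightarrow> ('a, 'w) dtree set" where
  "nfd (Leaf r) = {Leaf r}"
| "nfd (Decision ds) = (\<Union>(a, T)\<in>set ds. {Decision [(a, U)] |U. U \<in> nfd T})"
| "nfd (Chance cs) =
     {Chance (zip (map fst cs) Us) |Us. list_all2 (\<in>) Us (map (\<lambda>(E, T). nfd T) cs)}"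

text \<open>Only the values on normal form decisions are relevant.\<close>

fun nf_gamble :: "('a, 'w) dtree \<Rightarrow> 'w gamble" where
  "nf_gamble (Leaf r) = (\<lambda>w. r)"
| "nf_gamble (Decision [(a, U)]) = nf_gamble U"
| "nf_gamble (Decision _) = undefined"
| "nf_gamble (Chance cs) = (\<lambda>w. \<Sum>(E, U)\<leftarrow>cs. indicator E w * nf_gamble U w)"

definition gamb :: "('a, 'w) dtree \<Rightarrow> 'w gamble set" where
  "gamb U = {nf_gamble U}"

definition gamb_set :: "('a, 'w) dtree set \<Rightarrow> 'w gamble set" where
  "gamb_set \<U> = (\<Union>U\<in>\<U>. gamb U)"

definition gamb_tree :: "('a, 'w) dtree \<Rightarrow> 'w gamble set" where
  "gamb_tree T = gamb_set (nfd T)"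


section \<open>Normal form operators\<close>

definition norm_tree :: "'w choice \<Rightarrow> 'w set \<Rightarrow> ('a, 'w) dtree \<Rightarrow> ('a, 'w) dtree set" where
  "norm_tree opt A T = {U\<in>nfd T. gamb U \<subseteq> opt (gamb_tree T) A}"

definition norm_set :: "'w choice \<Rightarrow> 'w set \<Rightarrow> ('a, 'w) dtree set \<Rightarrow> ('a, 'w) dtree set" where
  "norm_set opt A \<U> = {U\<in>\<U>. gamb U \<subseteq> opt (gamb_set \<U>) A}"

fun backward :: "'w choice \<Rightarrow> 'w set \<Rightarrow> ('a, 'w) dtree \<Rightarrow> ('a, 'w) dtree set" where
  "backward opt A (Leaf r) = {Leaf r}"
| "backward opt A (Decision ds) = norm_set opt A
     {V \<in> nfd (Decision ds). \<exists>(a, T)\<in>set ds. \<exists>U\<in>backward opt A T. V = Decision [(a, U)]}"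
| "backward opt A (Chance cs) = norm_set opt A
     {V \<in> nfd (Chance cs). \<exists>Us. list_all2 (\<in>) Us (map (\<lambda>(E, T). backward opt (A \<inter> E) T) cs) \<and>
        V = Chance (zip (map fst cs) Us)}"

end

theory Submission
  imports Defs
begin

text \<open>
  If a normal form decision is maximal in a tree, then each of its restrictions is maximal in the
  corresponding subtree: a restriction dominated on \<open>A \<inter> E\<close> could be exchanged for the dominating
  one, and as all masses are positive the result would dominate on \<open>A\<close>. Interval dominance implies
  dominance in the sense of maximality, so backward induction with interval dominance never
  discards a maximal decision, and E-admissible decisions are maximal. Conversely, in a finite set
  every non-maximal (non-E-admissible) decision is beaten by a maximal (E-admissible) one, which is
  still present after backward induction.
\<close>

section \<open>Conditional expectations and strict dominance\<close>

lemma sum_pmf_pos: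
  assumes "credal_set M" "p \<in> M" "A \<noteq> {}"
  shows "(\<Sum>w\<in>A. p $ w) > 0"
  using assms by (intro sum_pos) (auto simp: credal_set_def)

lemma cexp_diff: "cexp p (\<lambda>w. Y w - X w) A = cexp p Y A - cexp p X A"
  by (simp add: cexp_def left_diff_distrib sum_subtractf diff_divide_distrib)

text \<open>The infimum is attained at some \<open>p\<close> in \<open>M\<close>, so strict
  inequality at every \<open>p\<close> survives taking it. Dominance in the sense of maximality thus
  becomes a pointwise strict order over \<open>M\<close>, which is visibly transitive.\<close>

lemma lower_exp_diff_pos_iff:
  assumes "credal_set M" "A \<noteq> {}"
  shows "lower_exp M (\<lambda>w. Y w - X w) A > 0 \<longleftrightarrow> (\<forall>p\<in>M. cexp p X A < cexp p Y A)"
proof -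
  obtain p where "p \<in> M" "lower_exp M (\<lambda>w. Y w - X w) A = cexp p Y A - cexp p X A"
    "\<forall>q\<in>M. cexp p Y A - cexp p X A \<le> cexp q Y A - cexp q X A"
    using lower_exp_attained[OF assms, of "\<lambda>w. Y w - X w"] unfolding cexp_diff by blast
  then show ?thesis
    by force
qed

lemma cexp_less_if_interval_dominates:
  assumes "credal_set M" "A \<noteq> {}" "lower_exp M Y A > upper_exp M X A" "p \<in> M"
  shows "cexp p X A < cexp p Y A"
proof -
  have "cexp p X A \<le> upper_exp M X A"
    using upper_exp_attained[OF assms(1,2), of X] assms(4) by force
  moreover have "lower_exp M Y A \<le> cexp p Y A"
    using lower_exp_attained[OF assms(1,2), of Y] assms(4) by force
  ultimately show ?thesis
    using assms(3) by linarith
qed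

text \<open>The numerators over \<open>A\<close> and over \<open>A \<inter> E\<close> are the same
  sum, and both denominators are positive; only the normalisation changes, hence not the
  sign.\<close>

lemma cexp_indicator_mult_pos:
  assumes "credal_set M" "p \<in> M" "A \<inter> E \<noteq> {}" "cexp p X (A \<inter> E) > 0"
  shows "cexp p (\<lambda>w. indicator E w * X w) A > 0"
proof -
  have "(\<Sum>w\<in>A \<inter> E. X w * p $ w) > 0"
    using assms(4) sum_pmf_pos[OF assms(1-3)] by (simp add: cexp_def zero_less_divide_iff)
  also have "(\<Sum>w\<in>A \<inter> E. X w * p $ w) = (\<Sum>w\<in>A. indicator E w * X w * p $ w)"
    by (subst sum.inter_restrict) (auto simp: indicator_def intro!: sum.cong)
  finally show ?thesis
    unfolding cexp_def using sum_pmf_pos[OF assms(1,2), of A] assms(3)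
    by (intro divide_pos_pos) auto
qed

section \<open>The three choice functions and smaller sets of options\<close>

lemma opt_max_iff:
  assumes "credal_set M" "A \<noteq> {}"
  shows "X \<in> opt_max M \<X> A \<longleftrightarrow>
    X \<in> \<X> \<and> (\<forall>Y\<in>\<X>. \<not> (\<forall>p\<in>M. cexp p X A < cexp p Y A))"
  using assms by (auto simp: opt_max_def lower_exp_diff_pos_iff)

lemma opt_max_subset_opt_int:
  assumes "credal_set M" "A \<noteq> {}"
  shows "opt_max M \<X> A \<subseteq> opt_int M \<X> A"
  unfolding opt_int_def using cexp_less_if_interval_dominates[OF assms]
  by (fastforce simp: opt_max_iff[OF assms])

text \<open>A maximiser of the expectation under one \<open>p\<close> in \<open>M\<close> cannot be
  strictly beaten under all of them.\<close>

lemma opt_adm_subset_opt_max: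
  assumes "credal_set M" "A \<noteq> {}"
  shows "opt_adm M \<X> A \<subseteq> opt_max M \<X> A"
  by (fastforce simp: opt_max_iff[OF assms] opt_adm_def not_less)

lemma opt_max_anti_mono:
  assumes "X \<in> opt_max M \<Y> A" "X \<in> \<X>" "\<X> \<subseteq> \<Y>"
  shows "X \<in> opt_max M \<X> A"
  using assms by (auto simp: opt_max_def)

lemma opt_adm_anti_mono:
  assumes "X \<in> opt_adm M \<Y> A" "X \<in> \<X>" "\<X> \<subseteq> \<Y>"
  shows "X \<in> opt_adm M \<X> A"
  using assms by (auto simp: opt_adm_def)

text \<open>Among the finitely many dominators of \<open>X\<close>, one with the largest expectation
  under a single fixed \<open>q\<close> is maximal in all of \<open>\<X>\<close>.\<close>

lemma opt_max_dominating:
  assumes "credal_set M" "A \<noteq> {}" "finite \<X>" "X \<in> \<X>" "X \<notin> opt_max M \<X> A"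
  obtains Y where "Y \<in> opt_max M \<X> A" "\<forall>p\<in>M. cexp p X A < cexp p Y A"
proof -
  define D where "D = {Y\<in>\<X>. \<forall>p\<in>M. cexp p X A < cexp p Y A}"
  \<comment> \<open>Any mass function in \<open>M\<close> will do: strict dominance strictly
    increases the expectation under each of them.\<close>
  obtain q where q: "q \<in> M"
    using assms(1) by (auto simp: credal_set_def)
  have "finite D" "D \<noteq> {}"
    using assms by (auto simp: D_def opt_max_iff)
  then obtain Y where Y: "Y \<in> D" "\<And>Z. Z \<in> D \<Longrightarrow> cexp q Z A \<le> cexp q Y A"
    using ex_is_arg_min_if_finite[of D "\<lambda>Y. - cexp q Y A"]
    by (auto simp: is_arg_min_linorder)
  have "Y \<in> opt_max M \<X> A"
    unfolding opt_max_iff[OF assms(1,2)]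
  proof (intro conjI ballI notI)
    \<comment> \<open>By transitivity \<open>Z\<close> dominates \<open>X\<close> as well, so it
      competes with \<open>Y\<close> inside \<open>D\<close>.\<close>
    fix Z assume Z: "Z \<in> \<X>" "\<forall>p\<in>M. cexp p Y A < cexp p Z A"
    then have "Z \<in> D"
      using Y(1) by (force simp: D_def)
    then show False
      using Y(2)[of Z] Z(2) q by force
  qed (use Y(1) in \<open>simp add: D_def\<close>)
  with that Y(1) show ?thesis
    by (auto simp: D_def)
qed

text \<open>Whatever is not maximal in \<open>\<Y>\<close> is dominated by something maximal in
  \<open>\<Y>\<close>, and that dominator still belongs to \<open>\<X>\<close>.\<close>

lemma opt_max_restrict:
  assumes "credal_set M" "A \<noteq> {}" "finite \<Y>" "opt_max M \<Y> A \<subseteq> \<X>" "\<X> \<subseteq> \<Y>"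
  shows "opt_max M \<X> A = opt_max M \<Y> A"
proof (intro equalityI subsetI)
  fix X assume X: "X \<in> opt_max M \<X> A"
  then have "X \<in> \<Y>"
    using assms(5) by (auto simp: opt_max_def)
  show "X \<in> opt_max M \<Y> A"
  proof (rule ccontr)
    assume "X \<notin> opt_max M \<Y> A"
    then obtain Y where "Y \<in> opt_max M \<Y> A" "\<forall>p\<in>M. cexp p X A < cexp p Y A"
      using opt_max_dominating[OF assms(1-3) \<open>X \<in> \<Y>\<close>] by blast
    then show False
      using X assms(4) unfolding opt_max_iff[OF assms(1,2), of _ \<X>] by blast
  qed
qed (use assms opt_max_anti_mono in blast)

text \<open>Fix the \<open>p\<close> for which \<open>X\<close> is best in \<open>\<X>\<close>. A
  best element \<open>Z\<close> of \<open>\<Y>\<close> under the same \<open>p\<close> is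
  E-admissible, hence lies in \<open>\<X>\<close>, so \<open>X\<close> does as well as
  \<open>Z\<close> and is best in \<open>\<Y>\<close> too.\<close>

lemma opt_adm_restrict:
  assumes "finite \<Y>" "opt_adm M \<Y> A \<subseteq> \<X>" "\<X> \<subseteq> \<Y>"
  shows "opt_adm M \<X> A = opt_adm M \<Y> A"
proof (intro equalityI subsetI)
  fix X assume "X \<in> opt_adm M \<X> A"
  then obtain p where p: "p \<in> M" "X \<in> \<X>" "\<And>Y. Y \<in> \<X> \<Longrightarrow> cexp p Y A \<le> cexp p X A"
    by (auto simp: opt_adm_def)
  then obtain Z where Z: "Z \<in> \<Y>" "\<And>Y. Y \<in> \<Y> \<Longrightarrow> cexp p Y A \<le> cexp p Z A"
    using ex_is_arg_min_if_finite[OF assms(1), of "\<lambda>Y. - cexp p Y A"] assms(3)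
    by (auto simp: is_arg_min_linorder)
  then have "Z \<in> \<X>"
    using p(1) assms(2) by (auto simp: opt_adm_def)
  then show "X \<in> opt_adm M \<Y> A"
    using p Z assms(3) by (force simp: opt_adm_def)
qed (use assms opt_adm_anti_mono in blast)

section \<open>Normal form decisions: finiteness, membership, consistency of subtrees\<close>

lemma finite_list_all2_mem:
  assumes "\<forall>S\<in>set Ss. finite S"
  shows "finite {xs. list_all2 (\<in>) xs Ss}"
  using assms
proof (induction Ss)
  case (Cons S Ss)
  have "{xs. list_all2 (\<in>) xs (S # Ss)} = case_prod (#) ` (S \<times> {xs. list_all2 (\<in>) xs Ss})"
    by (auto simp: list_all2_Cons2)
  with Cons show ?case
    by simp
qed simp

text \<open>Ensures that the set of gambles of a tree is finite, so that the maximisers used for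
  comparing choices exist.\<close>

lemma finite_nfd: "finite (nfd T)"
proof (induction T rule: nfd.induct)
  case (2 ds)
  then show ?case
    by (auto simp: setcompr_eq_image)
next
  case (3 cs)
  have "finite {Us. list_all2 (\<in>) Us (map (\<lambda>(E, T). nfd T) cs)}"
    using 3 by (intro finite_list_all2_mem) auto
  then show ?case
    by (auto simp: setcompr_eq_image)
qed simp

lemma gamb_set_eq: "gamb_set \<U> = nf_gamble ` \<U>"
  by (auto simp: gamb_set_def gamb_def)

lemma norm_tree_iff: "U \<in> norm_tree opt A T \<longleftrightarrow> U \<in> nfd T \<and> nf_gamble U \<in> opt (nf_gamble ` nfd T) A"
  by (auto simp: norm_tree_def gamb_tree_def gamb_set_eq gamb_def)

lemma norm_set_iff: "U \<in> norm_set opt A \<U> \<longleftrightarrow> U \<in> \<U> \<and> nf_gamble U \<in> opt (nf_gamble ` \<U>) A"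
  by (auto simp: norm_set_def gamb_set_eq gamb_def)

lemma backward_subset_nfd: "backward opt A T \<subseteq> nfd T"
  by (cases T) (auto simp: norm_set_def)

lemma root_mem_subtrees: "(A, T) \<in> subtrees A T"
  by (cases T) auto

lemma consistent_nonempty: "consistent A T \<Longrightarrow> A \<noteq> {}"
  using root_mem_subtrees by (force simp: consistent_def)

lemma consistent_Decision:
  "consistent A (Decision ds) \<Longrightarrow> (a, T) \<in> set ds \<Longrightarrow> consistent A T"
  by (fastforce simp: consistent_def)

lemma consistent_Chance:
  "consistent A (Chance cs) \<Longrightarrow> (E, T) \<in> set cs \<Longrightarrow> consistent (A \<inter> E) T"
  by (fastforce simp: consistent_def)

section \<open>Restrictions of maximal decisions to subtrees\<close>

lemma sum_list_zip_update_diff: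
  fixes f :: "'b \<Rightarrow> 'c \<Rightarrow> real"
  assumes "length xs = length ys" "i < length xs"
  shows "(\<Sum>(x, y)\<leftarrow>zip xs (ys[i := z]). f x y) - (\<Sum>(x, y)\<leftarrow>zip xs ys. f x y)
    = f (xs ! i) z - f (xs ! i) (ys ! i)"
  using assms
proof (induction xs ys arbitrary: i rule: list_induct2)
  case (Cons x xs y ys)
  then show ?case
    by (cases i) auto
qed simp

text \<open>Only the summand of the exchanged arc changes; the difference has the form to which
  \<open>cexp_indicator_mult_pos\<close> applies.\<close>

lemma nf_gamble_Chance_update_diff:
  assumes "i < length Es" "length Us = length Es"
  shows "nf_gamble (Chance (zip Es (Us[i := V]))) w - nf_gamble (Chance (zip Es Us)) w
    = indicator (Es ! i) w * (nf_gamble V w - nf_gamble (Us ! i) w)"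
  using sum_list_zip_update_diff[of Es Us i, OF assms(2)[symmetric] assms(1), of "\<lambda>E U. indicator E w * nf_gamble U w" V]
  by (simp add: right_diff_distrib)

text \<open>Choosing arc \<open>a\<close> changes neither event nor gamble, so every option of
  \<open>T\<close> is also an option of the whole tree, and maximality passes to the smaller
  set.\<close>

lemma norm_tree_opt_max_Decision:
  assumes "Decision [(a, U)] \<in> norm_tree (opt_max M) A (Decision ds)"
    and "(a, T) \<in> set ds" "U \<in> nfd T"
  shows "U \<in> norm_tree (opt_max M) A T"
proof -
  have "nf_gamble ` nfd T \<subseteq> nf_gamble ` nfd (Decision ds)"
  proof
    fix X assume "X \<in> nf_gamble ` nfd T"
    then obtain V where "V \<in> nfd T" "X = nf_gamble (Decision [(a, V)])"
      by auto
    then show "X \<in> nf_gamble ` nfd (Decision ds)"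
      using assms(2) by (intro image_eqI[of _ _ "Decision [(a, V)]"]) auto
  qed
  with assms show ?thesis
    by (auto simp: norm_tree_iff intro: opt_max_anti_mono)
qed

lemma norm_tree_opt_max_Chance:
  assumes M: "credal_set M" and cons: "consistent A (Chance cs)"
    and Us: "list_all2 (\<in>) Us (map (\<lambda>(E, T). nfd T) cs)"
    and opt: "Chance (zip (map fst cs) Us) \<in> norm_tree (opt_max M) A (Chance cs)"
    and i: "i < length cs" "cs ! i = (E, T)"
  shows "Us ! i \<in> norm_tree (opt_max M) (A \<inter> E) T"
proof -
  \<comment> \<open>Consistency keeps both conditioning events non-empty, so conditional
    expectations on them have positive denominators.\<close>
  have A: "A \<noteq> {}" "A \<inter> E \<noteq> {}"
    using cons consistent_Chance[OF cons, of E T] i nth_mem[of i cs] consistent_nonempty by metis+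
  have len: "length Us = length cs"
    using list_all2_lengthD[OF Us] by simp
  let ?g = "\<lambda>Us. nf_gamble (Chance (zip (map fst cs) Us))"
  have Ui: "Us ! i \<in> nfd T"
    using list_all2_nthD2[OF Us, of i] i by simp
  have "\<not> (\<forall>p\<in>M. cexp p (nf_gamble (Us ! i)) (A \<inter> E) < cexp p (nf_gamble V) (A \<inter> E))"
    if V: "V \<in> nfd T" for V
  proof
    assume dom: "\<forall>p\<in>M. cexp p (nf_gamble (Us ! i)) (A \<inter> E) < cexp p (nf_gamble V) (A \<inter> E)"
    \<comment> \<open>\<open>list_all2_update_cong\<close> updates both lists at \<open>i\<close>;
      on the right the update puts back the entry already there.\<close>
    have "list_all2 (\<in>) (Us[i := V]) ((map (\<lambda>(E, T). nfd T) cs)[i := nfd T])"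
      using V by (intro list_all2_update_cong[OF Us]) auto
    moreover have "(map (\<lambda>(E, T). nfd T) cs)[i := nfd T] = map (\<lambda>(E, T). nfd T) cs"
      using i by (simp add: list_update_same_conv)
    ultimately have "?g (Us[i := V]) \<in> nf_gamble ` nfd (Chance cs)"
      by (intro imageI) auto
    moreover have "cexp p (?g Us) A < cexp p (?g (Us[i := V])) A" if p: "p \<in> M" for p
    proof -
      have "cexp p (\<lambda>w. nf_gamble V w - nf_gamble (Us ! i) w) (A \<inter> E) > 0"
        using dom p by (simp add: cexp_diff)
      then have "cexp p (\<lambda>w. indicator E w * (nf_gamble V w - nf_gamble (Us ! i) w)) A > 0"
        by (rule cexp_indicator_mult_pos[OF M p A(2)])
      also have "(\<lambda>w. indicator E w * (nf_gamble V w - nf_gamble (Us ! i) w))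
          = (\<lambda>w. ?g (Us[i := V]) w - ?g Us w)"
        using i len by (subst nf_gamble_Chance_update_diff) auto
      finally show ?thesis
        by (simp only: cexp_diff diff_gt_0_iff_gt)
    qed
    ultimately show False
      using opt unfolding norm_tree_iff opt_max_iff[OF M A(1)] by blast
  qed
  with Ui show ?thesis
    by (auto simp: norm_tree_iff opt_max_iff[OF M A(2)])
qed

section \<open>Maximal decisions survive backward induction\<close>

text \<open>The selection step at a single node, where \<open>\<U>\<close> is the set of candidates
  assembled from the children: maximality is inherited by \<open>\<U>\<close> and implies being
  undominated in the interval sense.\<close>

lemma norm_set_opt_int_if_norm_tree_opt_max:
  assumes "credal_set M" "A \<noteq> {}" "U \<in> norm_tree (opt_max M) A T" "U \<in> \<U>" "\<U> \<subseteq> nfd T"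
  shows "U \<in> norm_set (opt_int M) A \<U>"
proof -
  have "nf_gamble U \<in> opt_max M (nf_gamble ` \<U>) A"
    using assms(3-5) opt_max_anti_mono[of "nf_gamble U" M "nf_gamble ` nfd T"]
    by (simp add: norm_tree_iff image_mono)
  then show ?thesis
    using assms(4) opt_max_subset_opt_int[OF assms(1,2)] by (auto simp: norm_set_iff)
qed

lemma norm_tree_opt_max_subset_backward:
  assumes "credal_set M" "consistent A T"
  shows "norm_tree (opt_max M) A T \<subseteq> backward (opt_int M) A T"
  using assms(2)
\<comment> \<open>The recursion of \<open>subtrees\<close> replaces \<open>A\<close> by
  \<open>A \<inter> E\<close> below a chance arc, exactly as \<open>backward\<close> does.\<close>
proof (induction A T rule: subtrees.induct)
  case (1 A r)
  then show ?case
    by (auto simp: norm_tree_iff)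
next
  case (2 A ds)
  show ?case
  proof
    fix V assume V: "V \<in> norm_tree (opt_max M) A (Decision ds)"
    then have V_nfd: "V \<in> nfd (Decision ds)"
      by (simp only: norm_tree_iff)
    then obtain a T U where U: "(a, T) \<in> set ds" "U \<in> nfd T" "V = Decision [(a, U)]"
      by auto
    then have "U \<in> norm_tree (opt_max M) A T"
      using V norm_tree_opt_max_Decision[of a U M A ds T] by blast
    then have "U \<in> backward (opt_int M) A T"
      using 2(1)[OF U(1) refl] consistent_Decision[OF 2(2) U(1)] by blast
    then show "V \<in> backward (opt_int M) A (Decision ds)"
      using U(1,3) V_nfd unfolding backward.simps
      by (intro norm_set_opt_int_if_norm_tree_opt_max[OF assms(1) consistent_nonempty[OF 2(2)] V])
        blast+
  qed
next
  case (3 A cs)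
  show ?case
  proof
    fix V assume V: "V \<in> norm_tree (opt_max M) A (Chance cs)"
    then have V_nfd: "V \<in> nfd (Chance cs)"
      by (simp only: norm_tree_iff)
    then obtain Us where Us: "list_all2 (\<in>) Us (map (\<lambda>(E, T). nfd T) cs)"
      "V = Chance (zip (map fst cs) Us)"
      by auto
    have "list_all2 (\<in>) Us (map (\<lambda>(E, T). backward (opt_int M) (A \<inter> E) T) cs)"
    proof (rule list_all2_all_nthI)
      show "length Us = length (map (\<lambda>(E, T). backward (opt_int M) (A \<inter> E) T) cs)"
        using list_all2_lengthD[OF Us(1)] by simp
      fix i assume "i < length Us"
      then have i: "i < length cs"
        using list_all2_lengthD[OF Us(1)] by simp
      obtain E T where ET: "cs ! i = (E, T)"
        by fastforce
      then have mem: "(E, T) \<in> set cs"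
        using i nth_mem by metis
      have "Us ! i \<in> norm_tree (opt_max M) (A \<inter> E) T"
        using norm_tree_opt_max_Chance[OF assms(1) 3(2) Us(1) _ i ET] V Us(2) by blast
      then have "Us ! i \<in> backward (opt_int M) (A \<inter> E) T"
        using 3(1)[OF mem refl] consistent_Chance[OF 3(2) mem] by blast
      then show "Us ! i \<in> map (\<lambda>(E, T). backward (opt_int M) (A \<inter> E) T) cs ! i"
        using i ET by simp
    qed
    then show "V \<in> backward (opt_int M) A (Chance cs)"
      using Us(2) V_nfd unfolding backward.simps
      by (intro norm_set_opt_int_if_norm_tree_opt_max[OF assms(1) consistent_nonempty[OF 3(2)] V])
        blast+
  qed
qed

text \<open>Reduces an equality of sets of decisions to one of sets of optimal gambles. The
  inclusion in \<open>\<U>\<close> is asked of decisions, since different decisions may share a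
  gamble.\<close>

lemma norm_tree_eq_norm_set:
  assumes "opt (nf_gamble ` \<U>) A = opt (nf_gamble ` nfd T) A"
    and "norm_tree opt A T \<subseteq> \<U>" "\<U> \<subseteq> nfd T"
  shows "norm_tree opt A T = norm_set opt A \<U>"
  using assms by (auto simp: norm_tree_iff norm_set_iff)

theorem corollary22:
  fixes M :: "(real ^ 'w::finite) set"
    and A :: "'w set"
    and T :: "('a, 'w) dtree"
  assumes "credal_set M"
    and "well_formed T"
    and "consistent A T"
  shows "norm_tree (opt_max M) A T = norm_set (opt_max M) A (backward (opt_int M) A T)
    \<and> norm_tree (opt_adm M) A T = norm_set (opt_adm M) A (backward (opt_int M) A T)"
proof -
  let ?B = "backward (opt_int M) A T"
  let ?G = "nf_gamble ` nfd T"
  have A: "A \<noteq> {}"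
    using assms(3) by (rule consistent_nonempty)
  note adm_max = opt_adm_subset_opt_max[OF assms(1) A]
  have B: "norm_tree (opt_max M) A T \<subseteq> ?B" "?B \<subseteq> nfd T"
    using norm_tree_opt_max_subset_backward[OF assms(1,3)] backward_subset_nfd by blast+
  \<comment> \<open>Each maximal gamble is the gamble of a decision in
    \<open>norm_tree (opt_max M) A T\<close>, which backward induction keeps.\<close>
  have max: "opt_max M ?G A \<subseteq> nf_gamble ` ?B"
  proof
    fix X assume X: "X \<in> opt_max M ?G A"
    then obtain U where "U \<in> nfd T" "X = nf_gamble U"
      by (auto simp: opt_max_def)
    with X B(1) show "X \<in> nf_gamble ` ?B"
      by (auto simp: norm_tree_iff)
  qed
  have G: "finite ?G" "nf_gamble ` ?B \<subseteq> ?G"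
    using finite_nfd B(2) by auto
  have "norm_tree (opt_adm M) A T \<subseteq> ?B"
    using B(1) subsetD[OF adm_max] unfolding subset_iff norm_tree_iff by blast
  then show ?thesis
    using norm_tree_eq_norm_set B opt_max_restrict[OF assms(1) A G(1) max G(2)]
      opt_adm_restrict[OF G(1) order_trans[OF adm_max max] G(2)]
    by metis
qed

end
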